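(* Let $\mathcal{H}$ be a complex Hilbert space, let $x,y\in\mathcal{H}$ and let $\lambda\in(0,1)$. Then $$\lim_{n\to+\infty}\omega\big(M_\lambda^{(n)}(x\otimes y)\big)=r(x\otimes y).$$
   Context: $x\otimes y$ denotes the operator on $\mathcal{H}$ given by $(x\otimes y)z:=\langle z,y\rangle x$ for $z\in\mathcal{H}$ (the inner product is linear in its first argument). $r(\cdot)$ is the spectral radius and $\omega(A)=\sup\{|\langle Az,z\rangle|:\ z\in\mathcal{H},\ \|z\|=1\}$ is the numerical radius. For a bounded operator $T$ on $\mathcal{H}$, $T=U|T|$ denotes the canonical polar decomposition: $|T|=(T^*T)^{1/2}$ and $U$ is the unique partial isometry with $T=U|T|$ and $\mathcal{N}(U)=\mathcal{N}(T)$ (null spaces). The Duggal transform of $T$ is $T^D:=|T|U$, and for $\lambda\in[0,1]$ the $\lambda$-mean transform is $M_\lambda(T):=\lambda T+(1-\lambda)T^D$. The iterates are $M_\lambda^{(0)}(T)=T$ and $M_\lambda^{(n+1)}(T)=M_\lambda\big(M_\lambda^{(n)}(T)\big)$ for $n\ge0$. *)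

theory Defs
  imports "HOL-Analysis.Analysis"
begin

text \<open>
  A complex Hilbert space is a complete real inner product space that carries in addition a
  complex scalar multiplication extending the real one and a complex inner product (linear in
  its first argument) whose real part is the real inner product.  In particular the norm is the one
  induced by the complex inner product, see \<open>cinner_same\<close> below.
\<close>

class chilbert_space = real_inner + complete_space +
  fixes scaleC :: "complex \<Rightarrow> 'a \<Rightarrow> 'a" (infixr "*\<^sub>C" 75)
    and cinner :: "'a \<Rightarrow> 'a \<Rightarrow> complex"
  assumes scaleC_add_right: "a *\<^sub>C (x + y) = a *\<^sub>C x + a *\<^sub>C y"
    and scaleC_add_left: "(a + b) *\<^sub>C x = a *\<^sub>C x + b *\<^sub>C x"
    and scaleC_scaleC: "a *\<^sub>C (b *\<^sub>C x) = (a * b) *\<^sub>C x"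
    and scaleC_of_real: "complex_of_real r *\<^sub>C x = r *\<^sub>R x"
    and cinner_commute: "cinner x y = cnj (cinner y x)"
    and cinner_add_left: "cinner (x + y) z = cinner x z + cinner y z"
    and cinner_scaleC_left: "cinner (a *\<^sub>C x) y = a * cinner x y"
    and inner_eq_Re_cinner: "x \<bullet> y = Re (cinner x y)"

lemma cinner_same: "cinner x x = complex_of_real ((norm x)\<^sup>2)"
  for x :: "'a::chilbert_space"
proof -
  have "Im (cinner x x) = 0"
    using cinner_commute[of x x] by (metis cnj.simps(2) neg_equal_zero)
  then show ?thesis
    by (simp add: complex_eq_iff power2_norm_eq_inner inner_eq_Re_cinner)
qed

instantiation complex :: chilbert_space
begin

definition scaleC_complex :: "complex \<Rightarrow> complex \<Rightarrow> complex"
  where "scaleC_complex a x = a * x"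

definition cinner_complex :: "complex \<Rightarrow> complex \<Rightarrow> complex"
  where "cinner_complex x y = x * cnj y"

instance
  by standard
    (simp_all add: scaleC_complex_def cinner_complex_def algebra_simps inner_complex_def
      scaleR_conv_of_real)

end

definition bounded_clinear :: "('a::chilbert_space \<Rightarrow> 'a) \<Rightarrow> bool"
  where "bounded_clinear T \<longleftrightarrow> bounded_linear T \<and> (\<forall>c z. T (c *\<^sub>C z) = c *\<^sub>C T z)"

definition rank_one :: "'a::chilbert_space \<Rightarrow> 'a \<Rightarrow> 'a \<Rightarrow> 'a" (infix "\<otimes>\<^sub>H" 70)
  where "(x \<otimes>\<^sub>H y) = (\<lambda>z. cinner z y *\<^sub>C x)"

text \<open>
  The definite descriptions below (adjoint, positive square root, polar factor) are to be applied
  to bounded operators (positive ones in the case of the square root); there the described object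
  exists and is unique by the classical theorems.
\<close>

definition cadjoint :: "('a::chilbert_space \<Rightarrow> 'a) \<Rightarrow> 'a \<Rightarrow> 'a"
  where "cadjoint T = (THE S. bounded_clinear S \<and> (\<forall>u v. cinner (T u) v = cinner u (S v)))"

definition positive_op :: "('a::chilbert_space \<Rightarrow> 'a) \<Rightarrow> bool"
  where "positive_op P \<longleftrightarrow> bounded_clinear P \<and> (\<forall>z. cinner (P z) z \<in> \<real>\<^sub>\<ge>\<^sub>0)"

definition sqrt_op :: "('a::chilbert_space \<Rightarrow> 'a) \<Rightarrow> 'a \<Rightarrow> 'a"
  where "sqrt_op A = (THE P. positive_op P \<and> P \<circ> P = A)"

definition abs_op :: "('a::chilbert_space \<Rightarrow> 'a) \<Rightarrow> 'a \<Rightarrow> 'a"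
  where "abs_op T = sqrt_op (cadjoint T \<circ> T)"

definition null_space :: "('a::chilbert_space \<Rightarrow> 'a) \<Rightarrow> 'a set"
  where "null_space T = {z. T z = 0}"

definition partial_isometry :: "('a::chilbert_space \<Rightarrow> 'a) \<Rightarrow> bool"
  where "partial_isometry U \<longleftrightarrow> bounded_clinear U \<and>
    (\<forall>z. (\<forall>w\<in>null_space U. cinner z w = 0) \<longrightarrow> norm (U z) = norm z)"

definition polar_factor :: "('a::chilbert_space \<Rightarrow> 'a) \<Rightarrow> 'a \<Rightarrow> 'a"
  where "polar_factor T =
    (THE U. partial_isometry U \<and> T = U \<circ> abs_op T \<and> null_space U = null_space T)"

definition duggal :: "('a::chilbert_space \<Rightarrow> 'a) \<Rightarrow> 'a \<Rightarrow> 'a"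
  where "duggal T = abs_op T \<circ> polar_factor T"

definition mean_transform :: "real \<Rightarrow> ('a::chilbert_space \<Rightarrow> 'a) \<Rightarrow> 'a \<Rightarrow> 'a"
  where "mean_transform l T = (\<lambda>z. l *\<^sub>R T z + (1 - l) *\<^sub>R duggal T z)"

definition op_spectrum :: "('a::chilbert_space \<Rightarrow> 'a) \<Rightarrow> complex set"
  where "op_spectrum T = {c. \<not> (\<exists>S. bounded_clinear S \<and>
    S \<circ> (\<lambda>z. T z - c *\<^sub>C z) = id \<and> (\<lambda>z. T z - c *\<^sub>C z) \<circ> S = id)}"

text \<open>
  Inserting 0 in the two suprema only matters on the zero space, where the sets of values are empty
  and the supremum of the empty set of nonnegative reals is meant to be 0; the library leaves the
  real \<open>Sup {}\<close> unspecified.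
\<close>

definition spectral_radius :: "('a::chilbert_space \<Rightarrow> 'a) \<Rightarrow> real"
  where "spectral_radius T = Sup (insert 0 (cmod ` op_spectrum T))"

definition numerical_radius :: "('a::chilbert_space \<Rightarrow> 'a) \<Rightarrow> real"
  where "numerical_radius T = Sup (insert 0 {cmod (cinner (T z) z) |z. norm z = 1})"

end

theory Submission imports Defs begin

text \<open>
  For nonzero \<open>x\<close> and \<open>y\<close>, the polar decomposition of \<open>x \<otimes> y\<close> has
  \<open>|T| = (\<parallel>x\<parallel> / \<parallel>y\<parallel>) y \<otimes> y\<close> and \<open>U = (\<parallel>x\<parallel> \<parallel>y\<parallel>)\<^sup>-\<^sup>1 x \<otimes> y\<close>, so the Duggal transform is
  \<open>p \<otimes> y\<close> with \<open>p\<close> the orthogonal projection of \<open>x\<close> onto the line through \<open>y\<close>.  Hence the mean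
  transform only shrinks the component of \<open>x\<close> orthogonal to \<open>y\<close> by the factor \<open>\<lambda>\<close>, and the \<open>n\<close>-th
  iterate is \<open>x\<^sub>n \<otimes> y\<close> with \<open>x\<^sub>n = p + \<lambda>\<^sup>n (x - p)\<close> and \<open>\<langle>x\<^sub>n,y\<rangle> = \<langle>x,y\<rangle>\<close>.  Its numerical radius lies
  between \<open>|\<langle>x,y\<rangle>|\<close> and \<open>\<parallel>x\<^sub>n\<parallel> \<parallel>y\<parallel>\<close>, which tends to \<open>\<parallel>p\<parallel> \<parallel>y\<parallel> = |\<langle>x,y\<rangle>|\<close>; and the spectrum of
  \<open>x \<otimes> y\<close> is contained in \<open>{0, \<langle>x,y\<rangle>}\<close>.
\<close>

section \<open>Complex inner products\<close>

lemma cinner_add_right: "cinner x (y + z) = cinner x y + cinner x z"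
  by (subst (1 2 3) cinner_commute) (simp add: cinner_add_left)

lemma cinner_scaleC_right: "cinner x (c *\<^sub>C y) = cnj c * cinner x y"
  by (subst (1 2) cinner_commute) (simp add: cinner_scaleC_left)

lemma cinner_zero_left [simp]: "cinner 0 y = 0"
  using cinner_add_left[of 0 0 y] by simp

lemma cinner_zero_right [simp]: "cinner x 0 = 0"
  by (metis cinner_commute cinner_zero_left complex_cnj_zero)

lemma cinner_diff_left: "cinner (x - y) z = cinner x z - cinner y z"
  using cinner_add_left[of "x - y" y z] by simp

lemma cinner_scaleR_left: "cinner (r *\<^sub>R x) y = complex_of_real r * cinner x y"
  by (metis cinner_scaleC_left scaleC_of_real)

lemma cinner_scaleR_right: "cinner x (r *\<^sub>R y) = complex_of_real r * cinner x y"
  by (metis cinner_scaleC_right complex_cnj_complex_of_real scaleC_of_real)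

lemma scaleC_zero_left [simp]: "0 *\<^sub>C x = 0"
  using scaleC_of_real[of 0 x] by simp

lemma scaleC_one [simp]: "1 *\<^sub>C x = x"
  using scaleC_of_real[of 1 x] by simp

lemma scaleC_zero_right [simp]: "c *\<^sub>C 0 = 0"
  using scaleC_add_right[of c 0 0] by simp

lemma scaleC_minus_left: "(- c) *\<^sub>C x = - (c *\<^sub>C x)"
  using scaleC_add_left[of "- c" c x] by (simp add: eq_neg_iff_add_eq_0)

lemma scaleC_diff_right: "c *\<^sub>C (x - y) = c *\<^sub>C x - c *\<^sub>C y"
  using scaleC_add_right[of c "x - y" y] by simp

lemma scaleC_scaleR: "c *\<^sub>C (r *\<^sub>R x) = r *\<^sub>R (c *\<^sub>C x)"
  by (metis mult.commute scaleC_of_real scaleC_scaleC)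

lemma norm_scaleC: "norm (c *\<^sub>C x) = cmod c * norm x"
proof -
  have "complex_of_real ((norm (c *\<^sub>C x))\<^sup>2) = complex_of_real ((cmod c * norm x)\<^sup>2)"
    unfolding cinner_same[symmetric] cinner_scaleC_left cinner_scaleC_right
    using complex_norm_square[of c]
    by (simp add: cinner_same power_mult_distrib mult_ac)
  then show ?thesis
    by (simp only: of_real_eq_iff) (simp add: power2_eq_iff_nonneg)
qed

text \<open>Multiplying \<open>x\<close> by a scalar of modulus 1 makes the inner product real and
  nonnegative, which reduces the claim to the Cauchy-Schwarz inequality of the real inner
  product.\<close>

lemma cinner_norm_le: "cmod (cinner x y) \<le> norm x * norm y"
proof (cases "cinner x y = 0")
  case False
  define c where "c = cnj (sgn (cinner x y))"
  have "c * cinner x y = complex_of_real (cmod (cinner x y))"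
    using False complex_norm_square[of "cinner x y"]
    by (simp add: c_def sgn_eq field_simps power2_eq_square)
  then have "cmod (cinner x y) = (c *\<^sub>C x) \<bullet> y"
    by (simp add: inner_eq_Re_cinner cinner_scaleC_left)
  also have "\<dots> \<le> norm (c *\<^sub>C x) * norm y"
    by (rule norm_cauchy_schwarz)
  also have "norm (c *\<^sub>C x) = norm x"
    using False by (simp add: norm_scaleC c_def norm_sgn)
  finally show ?thesis .
qed simp

lemma cinner_self_eq_0: "cinner x x = 0 \<longleftrightarrow> x = 0" for x :: "'a::chilbert_space"
  by (simp add: cinner_same)

lemma cinner_ext:
  fixes x y :: "'a::chilbert_space"
  assumes "\<And>u. cinner u x = cinner u y"
  shows "x = y"
proof -
  have "cinner (x - y) (x - y) = cinner (x - y) (x + (-1) *\<^sub>C y)"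
    by (simp add: scaleC_minus_left)
  also have "\<dots> = 0"
    unfolding cinner_add_right cinner_scaleC_right by (simp add: assms)
  finally show ?thesis
    by (simp add: cinner_self_eq_0)
qed

text \<open>This is the orthogonal projection onto the line through \<open>y\<close>. For
  \<open>y = 0\<close> its value is 0, so the facts below hold for every \<open>y\<close>.\<close>

definition line_proj :: "'a::chilbert_space \<Rightarrow> 'a \<Rightarrow> 'a"
  where "line_proj y z = (cinner z y / cinner y y) *\<^sub>C y"

lemma cinner_line_proj: "cinner (line_proj y z) y = cinner z y"
  by (cases "y = 0") (simp_all add: line_proj_def cinner_scaleC_left cinner_self_eq_0)

lemma cinner_minus_line_proj: "cinner (z - line_proj y z) y = 0"
  by (simp add: cinner_diff_left cinner_line_proj)

lemma norm_line_proj_mult: "norm (line_proj y z) * norm y = cmod (cinner z y)"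
  using norm_scaleC[of "cinner z y / cinner y y" y]
  by (cases "y = 0") (simp_all add: line_proj_def cinner_same norm_divide norm_power
      power2_eq_square norm_mult)

section \<open>Bounded operators\<close>

lemma bounded_clinear_add: "bounded_clinear T \<Longrightarrow> T (u + v) = T u + T v"
  unfolding bounded_clinear_def by (blast intro: linear_add bounded_linear.linear)

lemma bounded_clinear_diff: "bounded_clinear T \<Longrightarrow> T (u - v) = T u - T v"
  unfolding bounded_clinear_def by (blast intro: linear_diff bounded_linear.linear)

lemma bounded_clinear_scaleC: "bounded_clinear T \<Longrightarrow> T (c *\<^sub>C u) = c *\<^sub>C T u"
  by (simp add: bounded_clinear_def)

lemma bounded_clinear_zero: "bounded_clinear T \<Longrightarrow> T 0 = 0"
  unfolding bounded_clinear_def by (blast intro: linear_0 bounded_linear.linear)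

text \<open>Every vector splits into a multiple of \<open>y\<close> and a vector orthogonal to
  \<open>y\<close>. This is the criterion behind the uniqueness of the square root and of the polar
  factor.\<close>

lemma bounded_clinear_eqI:
  fixes S T :: "'a::chilbert_space \<Rightarrow> 'a"
  assumes S: "bounded_clinear S" and T: "bounded_clinear T"
    and line: "S y = T y" and orth: "\<And>z. cinner z y = 0 \<Longrightarrow> S z = T z"
  shows "S = T"
proof
  fix z
  have "S (z - line_proj y z) = T (z - line_proj y z)"
    by (rule orth) (rule cinner_minus_line_proj)
  moreover have "S (line_proj y z) = T (line_proj y z)"
    by (simp add: line_proj_def bounded_clinear_scaleC[OF S] bounded_clinear_scaleC[OF T] line)
  ultimately show "S z = T z"
    by (simp add: bounded_clinear_diff[OF S] bounded_clinear_diff[OF T])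
qed

lemma rank_one_apply: "(x \<otimes>\<^sub>H y) z = cinner z y *\<^sub>C x"
  by (simp add: rank_one_def)

lemma bounded_clinear_rank_one: "bounded_clinear (x \<otimes>\<^sub>H y)"
  unfolding bounded_clinear_def rank_one_def
proof (intro conjI allI)
  show "bounded_linear (\<lambda>z. cinner z y *\<^sub>C x)"
  proof (rule bounded_linear_intro[where K = "norm y * norm x"])
    show "norm (cinner z y *\<^sub>C x) \<le> norm z * (norm y * norm x)" for z
      using mult_right_mono[OF cinner_norm_le norm_ge_zero]
      by (simp add: norm_scaleC mult.assoc)
  qed (simp_all add: cinner_add_left scaleC_add_left cinner_scaleR_left scaleC_of_real
      flip: scaleC_scaleC)
  show "cinner (c *\<^sub>C z) y *\<^sub>C x = c *\<^sub>C cinner z y *\<^sub>C x" for c z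
    by (simp add: cinner_scaleC_left scaleC_scaleC)
qed

section \<open>Adjoints and positive operators\<close>

lemma cadjoint_eqI:
  assumes S: "bounded_clinear S" and adj: "\<And>u v. cinner (T u) v = cinner u (S v)"
  shows "cadjoint T = S"
  unfolding cadjoint_def
proof (rule the_equality)
  show "bounded_clinear S \<and> (\<forall>u v. cinner (T u) v = cinner u (S v))"
    by (simp add: S adj)
next
  fix S' assume S': "bounded_clinear S' \<and> (\<forall>u v. cinner (T u) v = cinner u (S' v))"
  show "S' = S"
  proof
    fix v
    show "S' v = S v"
    proof (rule cinner_ext)
      show "cinner u (S' v) = cinner u (S v)" for u
        using S' adj[of u v] by simp
    qed
  qed
qed

lemma cadjoint_rank_one: "cadjoint (x \<otimes>\<^sub>H y) = y \<otimes>\<^sub>H x"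
proof (rule cadjoint_eqI)
  show "cinner ((x \<otimes>\<^sub>H y) u) v = cinner u ((y \<otimes>\<^sub>H x) v)" for u v
    using cinner_commute[of x v]
    by (simp add: rank_one_apply cinner_scaleC_left cinner_scaleC_right)
qed (rule bounded_clinear_rank_one)

lemma positive_op_selfadjoint:
  assumes "positive_op P"
  shows "cinner (P u) v = cinner u (P v)"
proof -
  have P: "bounded_clinear P" and real: "\<And>z. Im (cinner (P z) z) = 0"
    using assms by (auto simp: positive_op_def complex_nonneg_Reals_iff)
  have "Im (cinner (P u) v) + Im (cinner (P v) u) = 0"
    using real[of "u + v"] real[of u] real[of v]
    by (simp add: bounded_clinear_add[OF P] cinner_add_left cinner_add_right)
  moreover have "Re (cinner (P v) u) = Re (cinner (P u) v)"
    using real[of "u + \<i> *\<^sub>C v"] real[of u] real[of v]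
    by (simp add: bounded_clinear_add[OF P] bounded_clinear_scaleC[OF P] cinner_add_left
        cinner_add_right cinner_scaleC_left cinner_scaleC_right)
  ultimately have "cinner (P u) v = cnj (cinner (P v) u)"
    by (simp add: complex_eq_iff)
  then show ?thesis
    by (simp flip: cinner_commute)
qed

text \<open>For \<open>c > 0\<close>, the vector \<open>w = P u - c u\<close> satisfies
  \<open>P w = - c w\<close>, and positivity excludes a negative eigenvalue, so
  \<open>w = 0\<close>. For \<open>c = 0\<close>, self-adjointness turns the squared norm of
  \<open>P u\<close> into \<open>cinner u (P (P u)) = 0\<close>.\<close>

lemma positive_op_sqrt_eigenvector:
  assumes P: "positive_op P" and c: "0 \<le> c"
    and sq: "P (P u) = (complex_of_real c)\<^sup>2 *\<^sub>C u"
  shows "P u = complex_of_real c *\<^sub>C u"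
proof (cases "c = 0")
  case True
  have "cinner (P u) (P u) = cinner u (P (P u))"
    by (rule positive_op_selfadjoint[OF P])
  then show ?thesis
    using True sq by (simp add: cinner_self_eq_0)
next
  case False
  have lin: "bounded_clinear P"
    using P by (simp add: positive_op_def)
  define w where "w = P u - complex_of_real c *\<^sub>C u"
  have "P w = - (complex_of_real c *\<^sub>C w)"
    by (simp add: w_def bounded_clinear_diff[OF lin] bounded_clinear_scaleC[OF lin] sq
        scaleC_diff_right scaleC_scaleC power2_eq_square)
  then have "cinner (P w) w = - complex_of_real (c * (norm w)\<^sup>2)"
    by (metis cinner_scaleC_left cinner_same of_real_mult scaleC_minus_left mult_minus_left)
  moreover have "cinner (P w) w \<in> \<real>\<^sub>\<ge>\<^sub>0"
    using P by (simp add: positive_op_def)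
  ultimately have "c * (norm w)\<^sup>2 \<le> 0"
    by (simp add: complex_nonneg_Reals_iff)
  then have "w = 0"
    using c False by (simp add: mult_le_0_iff)
  then show ?thesis
    by (simp add: w_def)
qed

section \<open>Polar decomposition of a rank-one operator\<close>

lemma positive_op_rank_one:
  assumes "0 \<le> s"
  shows "positive_op ((s *\<^sub>R y) \<otimes>\<^sub>H y)"
  unfolding positive_op_def
proof (intro conjI allI bounded_clinear_rank_one)
  fix z
  have "cinner (((s *\<^sub>R y) \<otimes>\<^sub>H y) z) z = complex_of_real (s * (cmod (cinner z y))\<^sup>2)"
    using cinner_commute[of y z] complex_norm_square[of "cinner z y"]
    by (simp add: rank_one_apply cinner_scaleC_left cinner_scaleR_left)
  then show "cinner (((s *\<^sub>R y) \<otimes>\<^sub>H y) z) z \<in> \<real>\<^sub>\<ge>\<^sub>0"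
    using assms by simp
qed

text \<open>Any positive root must act on \<open>y\<close> as the scalar
  \<open>s * (norm y)^2\<close> and vanish on vectors orthogonal to \<open>y\<close>, because these
  are eigenvectors of its square.\<close>

lemma sqrt_op_rank_one:
  fixes y :: "'a::chilbert_space"
  assumes s: "0 \<le> s"
  shows "sqrt_op (((s * norm y)\<^sup>2 *\<^sub>R y) \<otimes>\<^sub>H y) = (s *\<^sub>R y) \<otimes>\<^sub>H y"
    (is "sqrt_op ?A = ?P")
  unfolding sqrt_op_def
proof (rule the_equality)
  have "?P (?P z) = ?A z" for z
    by (simp add: rank_one_apply cinner_scaleC_left cinner_scaleR_left cinner_same scaleC_scaleR
        power_mult_distrib power2_eq_square mult_ac flip: scaleC_of_real)
      (simp add: scaleC_scaleC mult_ac)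
  then show "positive_op ?P \<and> ?P \<circ> ?P = ?A"
    using positive_op_rank_one[OF s] by auto
next
  fix P assume "positive_op P \<and> P \<circ> P = ?A"
  then have P: "positive_op P" and sq: "\<And>z. P (P z) = ?A z"
    by (auto simp: fun_eq_iff)
  show "P = ?P"
  proof (rule bounded_clinear_eqI)
    show "bounded_clinear P"
      using P by (simp add: positive_op_def)
    show "bounded_clinear ?P"
      by (rule bounded_clinear_rank_one)
    have "P y = complex_of_real (s * (norm y)\<^sup>2) *\<^sub>C y"
    proof (rule positive_op_sqrt_eigenvector[OF P])
      show "P (P y) = (complex_of_real (s * (norm y)\<^sup>2))\<^sup>2 *\<^sub>C y"
        unfolding sq rank_one_apply cinner_same scaleC_of_real[symmetric] scaleC_scaleC
        by (simp add: power_mult_distrib power2_eq_square mult_ac)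
    qed (use s in simp)
    then show "P y = ?P y"
      by (simp add: rank_one_apply cinner_same mult_ac flip: scaleC_of_real of_real_power)
        (simp add: scaleC_scaleC mult_ac)
    show "P z = ?P z" if "cinner z y = 0" for z
      using positive_op_sqrt_eigenvector[OF P, of 0 z] that by (simp add: sq rank_one_apply)
  qed
qed

lemma abs_op_rank_one:
  fixes x y :: "'a::chilbert_space"
  shows "abs_op (x \<otimes>\<^sub>H y) = ((norm x / norm y) *\<^sub>R y) \<otimes>\<^sub>H y"
proof -
  have "cadjoint (x \<otimes>\<^sub>H y) \<circ> (x \<otimes>\<^sub>H y) = ((norm x / norm y * norm y)\<^sup>2 *\<^sub>R y) \<otimes>\<^sub>H y"
    \<comment> \<open>For \<open>y = 0\<close> the quotient defaults to 0, but both sides are the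
      zero operator; otherwise \<open>norm y\<close> cancels.\<close>
    by (cases "y = 0")
      (simp_all add: fun_eq_iff cadjoint_rank_one rank_one_apply cinner_scaleC_left cinner_same
        scaleC_scaleC flip: scaleC_of_real)
  then show ?thesis
    by (simp only: abs_op_def) (rule sqrt_op_rank_one, simp)
qed

lemma null_space_rank_one:
  fixes x y :: "'a::chilbert_space"
  assumes "x \<noteq> 0"
  shows "null_space (x \<otimes>\<^sub>H y) = {z. cinner z y = 0}"
proof -
  have "c *\<^sub>C x = 0 \<longleftrightarrow> c = 0" for c
    using norm_scaleC[of c x] assms by (metis mult_eq_0_iff norm_eq_zero scaleC_zero_left)
  then show ?thesis
    by (simp add: null_space_def rank_one_apply)
qed

lemma partial_isometry_rank_one:
  fixes x y :: "'a::chilbert_space"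
  assumes "x \<noteq> 0" "y \<noteq> 0" "norm x * norm y = 1"
  shows "partial_isometry (x \<otimes>\<^sub>H y)"
  unfolding partial_isometry_def
proof (intro conjI allI impI bounded_clinear_rank_one)
  fix z assume orth: "\<forall>w\<in>null_space (x \<otimes>\<^sub>H y). cinner z w = 0"
  define w where "w = z - line_proj y z"
  have wy: "cinner w y = 0"
    unfolding w_def by (rule cinner_minus_line_proj)
  then have "cinner z w = 0"
    using orth assms(1) by (simp add: null_space_rank_one)
  moreover have "cinner (line_proj y z) w = 0"
    using wy cinner_commute[of y w] by (simp add: line_proj_def cinner_scaleC_left)
  \<comment> \<open>\<open>w\<close> is the difference of two vectors orthogonal to it. Hence
    \<open>z\<close> lies on the line through \<open>y\<close>, where Cauchy-Schwarz is an
    equality.\<close>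
  ultimately have "cinner w w = 0"
    by (metis cinner_diff_left diff_zero w_def)
  then have "line_proj y z = z"
    by (simp add: cinner_self_eq_0 w_def)
  then have "cmod (cinner z y) = norm z * norm y"
    using norm_line_proj_mult[of y z] by simp
  then show "norm ((x \<otimes>\<^sub>H y) z) = norm z"
    using assms(3) by (simp add: rank_one_apply norm_scaleC mult_ac)
qed

text \<open>Uniqueness: the prescribed null space fixes the factor on vectors orthogonal to
  \<open>y\<close>. The factorization evaluated at \<open>y\<close> fixes it there, since
  \<open>y\<close> is an eigenvector of the absolute value with nonzero eigenvalue
  \<open>norm x * norm y\<close>.\<close>

lemma polar_factor_rank_one:
  fixes x y :: "'a::chilbert_space"
  assumes x: "x \<noteq> 0" and y: "y \<noteq> 0"
  shows "polar_factor (x \<otimes>\<^sub>H y) = ((1 / (norm x * norm y)) *\<^sub>R x) \<otimes>\<^sub>H y"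
    (is "_ = ?U")
  unfolding polar_factor_def
proof (rule the_equality)
  have "(x \<otimes>\<^sub>H y) z = ?U (abs_op (x \<otimes>\<^sub>H y) z)" for z
    using x y
    by (simp add: abs_op_rank_one rank_one_apply cinner_scaleC_left cinner_scaleR_left cinner_same
        scaleC_scaleC power2_eq_square flip: scaleC_of_real)
  then show "partial_isometry ?U \<and> x \<otimes>\<^sub>H y = ?U \<circ> abs_op (x \<otimes>\<^sub>H y) \<and>
      null_space ?U = null_space (x \<otimes>\<^sub>H y)"
    using x y partial_isometry_rank_one[of "(1 / (norm x * norm y)) *\<^sub>R x" y]
    by (auto simp: null_space_rank_one fun_eq_iff)
next
  fix V
  assume "partial_isometry V \<and> x \<otimes>\<^sub>H y = V \<circ> abs_op (x \<otimes>\<^sub>H y) \<and>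
    null_space V = null_space (x \<otimes>\<^sub>H y)"
  then have V: "bounded_clinear V" and polar: "\<And>z. (x \<otimes>\<^sub>H y) z = V (abs_op (x \<otimes>\<^sub>H y) z)"
    and null: "null_space V = {z. cinner z y = 0}"
    using x by (auto simp: partial_isometry_def fun_eq_iff null_space_rank_one)
  show "V = ?U"
  proof (rule bounded_clinear_eqI[OF V bounded_clinear_rank_one])
    define c where "c = complex_of_real (norm x * norm y)"
    have c: "c \<noteq> 0"
      using x y by (simp add: c_def)
    have "abs_op (x \<otimes>\<^sub>H y) y = c *\<^sub>C y"
      using y by (simp add: abs_op_rank_one rank_one_apply cinner_same c_def scaleC_scaleC
          power2_eq_square mult.commute flip: scaleC_of_real)
    then have "c *\<^sub>C V y = cinner y y *\<^sub>C x"
      using polar[of y] by (simp add: bounded_clinear_scaleC[OF V] rank_one_apply)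
    then have "V y = inverse c *\<^sub>C (cinner y y *\<^sub>C x)"
      using c by (metis left_inverse scaleC_one scaleC_scaleC)
    also have "\<dots> = ?U y"
      by (simp add: rank_one_apply c_def scaleC_scaleC mult_ac divide_inverse
          flip: scaleC_of_real)
    finally show "V y = ?U y" .
    show "V z = ?U z" if "cinner z y = 0" for z
      using null that by (auto simp: null_space_def rank_one_apply)
  qed
qed

section \<open>Duggal transform, mean transform and its iterates\<close>

lemma duggal_rank_one:
  fixes x y :: "'a::chilbert_space"
  shows "duggal (x \<otimes>\<^sub>H y) = line_proj y x \<otimes>\<^sub>H y"
proof (cases "x = 0 \<or> y = 0")
  case True
  then have zero: "x \<otimes>\<^sub>H y = 0 \<otimes>\<^sub>H 0" "line_proj y x \<otimes>\<^sub>H y = 0 \<otimes>\<^sub>H 0"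
    by (auto simp: rank_one_apply line_proj_def)
  \<comment> \<open>Only 0 is orthogonal to the whole space, which makes the zero operator a partial
    isometry and hence its own polar factor.\<close>
  have "z = 0" if "\<forall>w. cinner z w = 0" for z :: 'a
    using that cinner_self_eq_0 by blast
  then have "polar_factor (0 \<otimes>\<^sub>H 0) = (0 \<otimes>\<^sub>H 0 :: 'a \<Rightarrow> 'a)"
    unfolding polar_factor_def
    by (intro the_equality)
      (auto simp: abs_op_rank_one partial_isometry_def null_space_def rank_one_apply fun_eq_iff
        bounded_clinear_rank_one)
  then show ?thesis
    unfolding zero duggal_def by (simp add: abs_op_rank_one rank_one_apply fun_eq_iff)
next
  case False
  then show ?thesis
    by (simp add: duggal_def abs_op_rank_one polar_factor_rank_one fun_eq_iff rank_one_apply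
        line_proj_def cinner_scaleC_left cinner_scaleR_left cinner_same scaleC_scaleC
        power2_eq_square mult_ac flip: scaleC_of_real)
qed

lemma mean_transform_rank_one:
  "mean_transform l (x \<otimes>\<^sub>H y) = (l *\<^sub>R x + (1 - l) *\<^sub>R line_proj y x) \<otimes>\<^sub>H y"
  unfolding mean_transform_def duggal_rank_one
  by (simp add: rank_one_apply scaleC_add_right scaleC_scaleR fun_eq_iff)

lemma mean_transform_iterate_rank_one:
  "(mean_transform l ^^ n) (x \<otimes>\<^sub>H y) =
    (line_proj y x + l ^ n *\<^sub>R (x - line_proj y x)) \<otimes>\<^sub>H y"
proof (induction n)
  case (Suc n)
  let ?p = "line_proj y x"
  let ?x = "?p + l ^ n *\<^sub>R (x - ?p)"
  \<comment> \<open>The projection onto the line through \<open>y\<close> depends on a vector only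
    through its inner product with \<open>y\<close>, so it stays the same along the
    iteration.\<close>
  have "cinner ?x y = cinner x y"
    by (simp add: cinner_add_left cinner_scaleR_left cinner_line_proj cinner_minus_line_proj)
  then have "line_proj y ?x = ?p"
    by (simp add: line_proj_def)
  then show ?case
    by (simp add: Suc mean_transform_rank_one algebra_simps)
qed simp

section \<open>Numerical and spectral radius\<close>

text \<open>The upper bound applies Cauchy-Schwarz to both factors of
  \<open>cinner z y * cinner x z\<close>. The lower bound is the value at the unit vector along
  \<open>y\<close>, or the inserted 0 when \<open>y = 0\<close>.\<close>

lemma numerical_radius_rank_one_bounds:
  fixes x y :: "'a::chilbert_space"
  shows "cmod (cinner x y) \<le> numerical_radius (x \<otimes>\<^sub>H y)"
    and "numerical_radius (x \<otimes>\<^sub>H y) \<le> norm x * norm y"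
proof -
  let ?W = "insert 0 {cmod (cinner ((x \<otimes>\<^sub>H y) z) z) |z. norm z = 1}"
  have le: "v \<le> norm x * norm y" if "v \<in> ?W" for v
  proof -
    have "cmod (cinner ((x \<otimes>\<^sub>H y) z) z) \<le> norm x * norm y" if "norm z = 1" for z
      using mult_mono[OF cinner_norm_le[of z y] cinner_norm_le[of x z]] that
      by (simp add: rank_one_apply cinner_scaleC_left norm_mult mult.commute)
    then show ?thesis
      using that by auto
  qed
  then have bdd: "bdd_above ?W"
    by (rule bdd_aboveI)
  show "numerical_radius (x \<otimes>\<^sub>H y) \<le> norm x * norm y"
    unfolding numerical_radius_def using le by (intro cSup_least) auto
  show "cmod (cinner x y) \<le> numerical_radius (x \<otimes>\<^sub>H y)"
  proof (cases "y = 0")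
    case False
    define z where "z = (1 / norm y) *\<^sub>R y"
    have "norm z = 1"
      using False by (simp add: z_def)
    moreover have "cinner ((x \<otimes>\<^sub>H y) z) z = cinner x y"
      using False by (simp add: z_def rank_one_apply cinner_scaleC_left cinner_scaleR_left
          cinner_scaleR_right cinner_same power2_eq_square)
    ultimately have "cmod (cinner x y) \<in> ?W"
      by (metis (mono_tags, lifting) insertI2 mem_Collect_eq)
    then show ?thesis
      unfolding numerical_radius_def using bdd by (rule cSup_upper)
  qed (use cSup_upper[OF _ bdd, of 0] in \<open>simp add: numerical_radius_def\<close>)
qed

section \<open>Spectrum and spectral radius of a rank-one operator\<close>

lemma op_spectrum_rank_one_subset:
  fixes x y :: "'a::chilbert_space"
  shows "op_spectrum (x \<otimes>\<^sub>H y) \<subseteq> {0, cinner x y}"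
proof
  fix c assume c: "c \<in> op_spectrum (x \<otimes>\<^sub>H y)"
  show "c \<in> {0, cinner x y}"
  proof (rule ccontr)
    assume "c \<notin> {0, cinner x y}"
    then have c0: "c \<noteq> 0" and d0: "cinner x y - c \<noteq> 0"
      by auto
    \<comment> \<open>\<open>S\<close> is the Sherman-Morrison inverse of a rank-one perturbation of
      a scalar operator; it exists because \<open>c\<close> and \<open>d\<close> are
      nonzero.\<close>
    define d where "d = cinner x y - c"
    define S where "S = (\<lambda>w. (1 / c) *\<^sub>C ((cinner w y / d) *\<^sub>C x - w))"
    have S_eq: "S = (\<lambda>w. (((1 / (c * d)) *\<^sub>C x) \<otimes>\<^sub>H y) w - (1 / c) *\<^sub>C w)"
      by (simp add: S_def rank_one_apply scaleC_diff_right scaleC_scaleC fun_eq_iff)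
    have "bounded_linear (\<lambda>w::'a. (1 / c) *\<^sub>C w)"
      by (rule bounded_linear_intro[where K = "cmod (1 / c)"])
        (simp_all add: scaleC_add_right scaleC_scaleR norm_scaleC norm_divide)
    then have "bounded_clinear S"
      using bounded_clinear_rank_one[of "(1 / (c * d)) *\<^sub>C x" y]
      by (auto simp: S_eq bounded_clinear_def scaleC_diff_right scaleC_scaleC mult.commute
          intro: bounded_linear_sub)
    moreover have "S ((x \<otimes>\<^sub>H y) z - c *\<^sub>C z) = z" for z
    proof -
      have "cinner ((x \<otimes>\<^sub>H y) z - c *\<^sub>C z) y / d = cinner z y"
        using d0 by (simp add: rank_one_apply cinner_diff_left cinner_scaleC_left d_def field_simps)
      then show ?thesis
        using c0 by (simp add: S_def rank_one_apply scaleC_scaleC)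
    qed
    moreover have "(x \<otimes>\<^sub>H y) (S w) - c *\<^sub>C S w = w" for w
    proof -
      have "cinner (S w) y = cinner w y / d"
        using c0 d0 by (simp add: S_def cinner_diff_left cinner_scaleC_left d_def field_simps)
      then show ?thesis
        using c0 by (simp add: rank_one_apply) (simp add: S_def scaleC_scaleC)
    qed
    ultimately show False
      using c by (auto simp: op_spectrum_def fun_eq_iff)
  qed
qed

lemma eigenvalue_in_op_spectrum:
  assumes "T v = c *\<^sub>C v" and "v \<noteq> 0"
  shows "c \<in> op_spectrum T"
  unfolding op_spectrum_def mem_Collect_eq
proof
  assume "\<exists>S. bounded_clinear S \<and> S \<circ> (\<lambda>z. T z - c *\<^sub>C z) = id \<and>
    (\<lambda>z. T z - c *\<^sub>C z) \<circ> S = id"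
  then obtain S where "bounded_clinear S" and "\<And>z. S (T z - c *\<^sub>C z) = z"
    by (auto simp: fun_eq_iff)
  then show False
    using assms by (metis bounded_clinear_zero diff_self)
qed

text \<open>The maximum is attained because a nonzero \<open>x\<close> is an eigenvector with
  eigenvalue \<open>cinner x y\<close>; for \<open>x = 0\<close> the inserted 0 supplies it.\<close>

lemma spectral_radius_rank_one: "spectral_radius (x \<otimes>\<^sub>H y) = cmod (cinner x y)"
proof -
  let ?R = "insert 0 (cmod ` op_spectrum (x \<otimes>\<^sub>H y))"
  have "cmod (cinner x y) \<in> ?R"
  proof (cases "x = 0")
    case False
    then have "cinner x y \<in> op_spectrum (x \<otimes>\<^sub>H y)"
      by (intro eigenvalue_in_op_spectrum[of _ x]) (simp_all add: rank_one_apply)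
    then show ?thesis by blast
  qed simp
  moreover have "v \<le> cmod (cinner x y)" if "v \<in> ?R" for v
    using that op_spectrum_rank_one_subset[of x y] by auto
  ultimately show ?thesis
    unfolding spectral_radius_def by (rule cSup_eq_maximum)
qed

theorem theorem4p10:
  fixes x y :: "'a::chilbert_space" and l :: real
  assumes "0 < l" and "l < 1"
  shows "(\<lambda>n. numerical_radius ((mean_transform l ^^ n) (x \<otimes>\<^sub>H y)))
           \<longlonglongrightarrow> spectral_radius (x \<otimes>\<^sub>H y)"
proof -
  define p where "p = line_proj y x"
  define u where "u n = p + l ^ n *\<^sub>R (x - p)" for n
  have iter: "(mean_transform l ^^ n) (x \<otimes>\<^sub>H y) = u n \<otimes>\<^sub>H y" for n
    by (simp add: mean_transform_iterate_rank_one u_def p_def)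
  have "cinner (u n) y = cinner x y" for n
    by (simp add: u_def p_def cinner_add_left cinner_scaleR_left cinner_line_proj
        cinner_minus_line_proj)
  then have lower: "cmod (cinner x y) \<le> numerical_radius (u n \<otimes>\<^sub>H y)" for n
    using numerical_radius_rank_one_bounds(1)[of "u n" y] by simp
  have "(\<lambda>n. l ^ n) \<longlonglongrightarrow> 0"
    using assms by (intro LIMSEQ_power_zero) simp
  then have "(\<lambda>n. norm (u n) * norm y) \<longlonglongrightarrow> norm (p + 0 *\<^sub>R (x - p)) * norm y"
    unfolding u_def by (intro tendsto_add tendsto_mult tendsto_norm tendsto_scaleR tendsto_const)
  \<comment> \<open>The limit vector \<open>p\<close> is parallel to \<open>y\<close>, so
    Cauchy-Schwarz is an equality for it and the upper bounds converge to the constant lower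
    bound.\<close>
  then have "(\<lambda>n. norm (u n) * norm y) \<longlonglongrightarrow> cmod (cinner x y)"
    by (simp add: p_def norm_line_proj_mult)
  then have "(\<lambda>n. numerical_radius (u n \<otimes>\<^sub>H y)) \<longlonglongrightarrow> cmod (cinner x y)"
    by (rule tendsto_sandwich[OF _ _ tendsto_const, rotated 2])
      (simp_all add: lower numerical_radius_rank_one_bounds(2))
  then show ?thesis
    by (simp add: iter spectral_radius_rank_one)
qed

end
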